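(* For $n\in\mathbb{N}$ let $S_n=\frac{n(n+1)}{2}$ and $$V_n=\frac{\sqrt{S_n}}{n}+\frac{\sqrt{S_{n+1}}}{n+1}-\frac{\sqrt{S_n}}{n}\sqrt{1-\frac1n}-\frac{\sqrt{S_{n+1}}}{n+1}\sqrt{1+\frac1n}.$$ Let $\{a_n\}_{n\ge1}$ be any sequence of real or complex numbers, not identically zero, and let $A_n=\sum_{k=1}^{n}k a_k$ for $n\ge1$ and $A_0=0$. Then $$\sum_{n=1}^{\infty}\frac1{16}\,\frac{n}{S_n\sqrt{S_n}}\,|A_n|^2<\sum_{n=1}^{\infty}V_n|A_n|^2\le\sum_{n=1}^{\infty}\sqrt{S_n}\,\frac{|A_n-A_{n-1}|^2}{n}.$$ Moreover, the weight sequence $\{V_n\}$ is optimal: if $\{\widetilde V_n\}_{n\ge1}$ is a sequence with $\widetilde V_n\ge V_n$ for all $n\in\mathbb{N}$ such that $\sum_{n=1}^{\infty}\widetilde V_n|A_n|^2\le\sum_{n=1}^{\infty}\sqrt{S_n}\,\frac{|A_n-A_{n-1}|^2}{n}$ holds for all such sequences $\{A_n\}$, then $\widetilde V_n=V_n$ for all $n\in\mathbb{N}$.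
   Context: $\mathbb{N}=\{1,2,3,\dots\}$. The inequality is an improvement of the case $c=\frac32$ of the Copson inequality $\sum_{n\ge1} S_n^{2-c}\frac{|A_n-A_{n-1}|^2}{n}\ge\frac{(c-1)^2}{4}\sum_{n\ge1}\frac{n}{S_n^{c}}|A_n|^2$.
   Formalization: The strict first inequality is claimed only when the first sum is finite; otherwise (e.g. a_k = 1/k, so A_n = n) both of the first two sums are infinite and strictness fails. Divergent sums are read as +∞. *)

theory Defs
  imports Complex_Main "HOL-Library.Extended_Nonnegative_Real"
begin

text \<open>Sequences indexed by the positive integers are functions on \<^typ>\<open>nat\<close> whose value at 0
  plays no role.\<close>

definition S :: "nat \<Rightarrow> real" where
  "S n = real n * (real n + 1) / 2"

definition V :: "nat \<Rightarrow> real" where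
  "V n = sqrt (S n) / real n + sqrt (S (n + 1)) / real (n + 1)
       - sqrt (S n) / real n * sqrt (1 - 1 / real n)
       - sqrt (S (n + 1)) / real (n + 1) * sqrt (1 + 1 / real n)"

text \<open>The scalars range over an arbitrary type of class \<^class>\<open>real_normed_field\<close>. This covers
  \<^typ>\<open>real\<close> and \<^typ>\<open>complex\<close>, and by Gelfand--Mazur there are no other instances up to
  isometric isomorphism.\<close>

definition A :: "(nat \<Rightarrow> 'a::real_normed_field) \<Rightarrow> nat \<Rightarrow> 'a" where
  "A a n = (\<Sum>k=1..n. of_nat k * a k)"

text \<open>The series have nonnegative terms and may diverge, so they are taken in
  \<^typ>\<open>ennreal\<close>, and \<^term>\<open>Suc n\<close> makes them start at index 1. The function \<^const>\<open>ennreal\<close>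
  maps negative reals to 0, but \<open>V_pos\<close> below shows that this never happens for the
  weights \<open>w\<close> with \<open>w n \<ge> V n\<close>.\<close>

definition weighted_sum :: "(nat \<Rightarrow> real) \<Rightarrow> (nat \<Rightarrow> 'a::real_normed_field) \<Rightarrow> ennreal" where
  "weighted_sum w a = (\<Sum>n. ennreal (w (Suc n) * (norm (A a (Suc n)))\<^sup>2))"

definition copson_sum :: "(nat \<Rightarrow> 'a::real_normed_field) \<Rightarrow> ennreal" where
  "copson_sum a =
     (\<Sum>n. ennreal (sqrt (S (Suc n)) * (norm (A a (Suc n) - A a n))\<^sup>2 / real (Suc n)))"

lemma V_pos:
  assumes "n \<ge> 1"
  shows "0 < V n"
proof -
  define x where "x = 1 / real n"
  have x: "0 < x" "x \<le> 1" using assms by (auto simp: x_def)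
  define p q where "p = sqrt (1 - x)" and "q = sqrt (1 + x)"
  have p2: "p\<^sup>2 = 1 - x" and q2: "q\<^sup>2 = 1 + x" using x by (auto simp: p_def q_def)
  have pq: "p \<noteq> q" using p2 q2 x by auto
  have "0 < (p - q)\<^sup>2" using pq by simp
  hence "(p + q)\<^sup>2 < 2\<^sup>2" using p2 q2 by (simp add: power2_eq_square algebra_simps)
  hence sum: "p + q < 2" by (rule power2_less_imp_less) simp
  have q1: "1 \<le> q" using x by (simp add: q_def)
  define b c where "b = sqrt (S n) / real n" and "c = sqrt (S (n + 1)) / real (n + 1)"
  have ratio: "sqrt (S m) / real m = sqrt ((1 + 1 / real m) / 2)" if "m \<ge> 1" for m
  proof -
    have "S m / (real m)\<^sup>2 = (1 + 1 / real m) / 2"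
      using that by (simp add: S_def power2_eq_square field_simps)
    moreover have "sqrt (S m) / real m = sqrt (S m / (real m)\<^sup>2)"
      by (simp add: real_sqrt_divide)
    ultimately show ?thesis by simp
  qed
  have "1 / real (n + 1) \<le> 1 / real n"
    using assms by (intro divide_left_mono) auto
  hence "(1 + 1 / real (n + 1)) / 2 \<le> (1 + 1 / real n) / 2"
    by (intro divide_right_mono add_left_mono) auto
  hence cb: "c \<le> b" using assms unfolding b_def c_def
    by (subst (1 2) ratio) (auto intro: real_sqrt_le_mono)
  have b0: "0 < b" using assms by (simp add: b_def S_def)
  have "c * (q - 1) \<le> b * (q - 1)" using cb q1 by (simp add: mult_right_mono)
  also have "\<dots> < b * (1 - p)" using b0 sum by simp
  finally have "0 < b + c - b * p - c * q" by (simp add: algebra_simps)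
  thus ?thesis by (simp only: V_def b_def c_def p_def q_def x_def)
qed

end

(* Writing A_n = sqrt n * phi_n turns the Copson form minus the V-form into a sum of squares
   of the differences of phi plus a nonnegative boundary term; this gives the inequality.
   The same identity gives optimality: a cut-off phi that decreases logarithmically (harmonic
   numbers) has arbitrarily small energy, so no weight V_m can be enlarged. *)
theory Submission
  imports Defs "HOL-Analysis.Harmonic_Numbers"
begin

section \<open>Edge weights and the pointwise comparison of the two weight sequences\<close>

definition edge_weight :: "nat \<Rightarrow> real" where
  "edge_weight n = sqrt (S n) / real n"

lemma edge_weight_nonneg: "0 \<le> edge_weight n"
  by (simp add: edge_weight_def S_def)

lemma edge_weight_eq:
  assumes "n \<ge> 1"
  shows "edge_weight n = sqrt ((1 + 1 / real n) / 2)"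
proof -
  have "S n / (real n)\<^sup>2 = (1 + 1 / real n) / 2"
    using assms by (simp add: S_def power2_eq_square field_simps)
  moreover have "edge_weight n = sqrt (S n / (real n)\<^sup>2)"
    by (simp add: edge_weight_def real_sqrt_divide)
  ultimately show ?thesis by simp
qed

lemma edge_weight_le_1: "n \<ge> 1 \<Longrightarrow> edge_weight n \<le> 1"
  by (simp add: edge_weight_eq)

lemma edge_weight_Suc_le:
  assumes "n \<ge> 1"
  shows "edge_weight (Suc n) \<le> edge_weight n"
  using assms by (simp add: edge_weight_eq frac_le)

text \<open>Grouped by the two edges that meet at n: the coefficients are those that
  \<open>ground_state_step\<close> gives to the right end of the edge from n-1 to n and to the left
  end of the edge from n to n+1.\<close>

lemma V_eq:
  "V n = edge_weight n * (1 - sqrt (1 - 1 / real n))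
       + edge_weight (Suc n) * (1 - sqrt (1 + 1 / real n))"
  unfolding V_def edge_weight_def Suc_eq_plus1 by algebra

text \<open>x^2/4 is the leading Taylor term of the gap 2 - sqrt(1-x) - sqrt(1+x). Squaring reduces
  the claim to sqrt(1-x^2) <= 1 - x^2/2, and a second squaring proves that.\<close>

lemma sqrt_add_sqrt_le:
  fixes x :: real
  assumes "0 \<le> x" "x \<le> 1"
  shows "sqrt (1 - x) + sqrt (1 + x) \<le> 2 - x\<^sup>2 / 4"
proof (rule power2_le_imp_le)
  have "x\<^sup>2 \<le> 1" using assms by (simp add: power_le_one)
  then show "0 \<le> 2 - x\<^sup>2 / 4" by simp
  have "sqrt ((1 - x) * (1 + x)) \<le> ((1 - x) + (1 + x)) / 2 - x\<^sup>2 / 2"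
  proof (rule real_le_lsqrt)
    show "0 \<le> ((1 - x) + (1 + x)) / 2 - x\<^sup>2 / 2" using \<open>x\<^sup>2 \<le> 1\<close> by simp
    have "(((1 - x) + (1 + x)) / 2 - x\<^sup>2 / 2)\<^sup>2 = (1 - x) * (1 + x) + (x\<^sup>2 / 2)\<^sup>2"
      by (simp add: power2_eq_square field_simps)
    then show "(1 - x) * (1 + x) \<le> (((1 - x) + (1 + x)) / 2 - x\<^sup>2 / 2)\<^sup>2" by simp
  qed
  then have "2 * (sqrt (1 - x) * sqrt (1 + x)) \<le> 2 - x\<^sup>2"
    by (simp add: real_sqrt_mult)
  moreover have "(sqrt (1 - x) + sqrt (1 + x))\<^sup>2 = 2 + 2 * (sqrt (1 - x) * sqrt (1 + x))"
    using assms by (simp add: power2_sum)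
  moreover have "(2 - x\<^sup>2 / 4)\<^sup>2 = 4 - x\<^sup>2 + (x\<^sup>2 / 4)\<^sup>2"
    by (simp add: power2_eq_square field_simps)
  ultimately show "(sqrt (1 - x) + sqrt (1 + x))\<^sup>2 \<le> (2 - x\<^sup>2 / 4)\<^sup>2"
    by (smt (verit) zero_le_power2)
qed

text \<open>The factor 1 - sqrt(1 + 1/n) is not positive, so replacing
  \<open>edge_weight (Suc n)\<close> by \<open>edge_weight n\<close>, which is no smaller, can only
  lower \<open>V n\<close>; what remains is the gap bounded in
  \<open>sqrt_add_sqrt_le\<close>.\<close>

lemma V_lower_bound:
  assumes "n \<ge> 1"
  shows "edge_weight n / (4 * (real n)\<^sup>2) \<le> V n"
proof -
  define x where "x = 1 / real n"
  have x: "0 \<le> x" "x \<le> 1" using assms by (auto simp: x_def)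
  have "edge_weight n / (4 * (real n)\<^sup>2) = edge_weight n * (x\<^sup>2 / 4)"
    by (simp add: x_def power_divide)
  also have "\<dots> \<le> edge_weight n * (2 - sqrt (1 - x) - sqrt (1 + x))"
    using sqrt_add_sqrt_le[OF x] by (intro mult_left_mono edge_weight_nonneg) simp
  also have "\<dots> = edge_weight n * (1 - sqrt (1 - x)) - edge_weight n * (sqrt (1 + x) - 1)"
    by (simp add: algebra_simps)
  also have "\<dots> \<le> edge_weight n * (1 - sqrt (1 - x)) - edge_weight (Suc n) * (sqrt (1 + x) - 1)"
    using x by (intro diff_left_mono mult_right_mono edge_weight_Suc_le assms) auto
  also have "\<dots> = V n" by (simp add: V_eq x_def algebra_simps)
  finally show ?thesis .
qed

lemma copson_weight_less_V:
  assumes "n \<ge> 1"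
  shows "1 / 16 * (real n / (S n * sqrt (S n))) < V n"
proof -
  have S: "S n > 0" using assms by (simp add: S_def)
  have "1 / 16 * (real n / (S n * sqrt (S n))) = sqrt (S n) * (real n / (16 * (S n)\<^sup>2))"
    using S by (simp add: field_simps power2_eq_square)
  also have "\<dots> < sqrt (S n) * (1 / (4 * real n ^ 3))"
  proof (rule mult_strict_left_mono)
    \<comment> \<open>Cancelling leaves (n+1)^2 where the lower bound for \<open>V n\<close> has
      n^2; this is the source of strictness.\<close>
    have "real n / (16 * (S n)\<^sup>2) = 1 / (4 * (real n * (real n + 1)\<^sup>2))"
      using assms by (simp add: S_def power_mult_distrib power_divide) (simp add: power2_eq_square)
    also have "\<dots> < 1 / (4 * (real n * (real n)\<^sup>2))"
      using assms
      by (intro divide_strict_left_mono mult_strict_left_mono power_strict_mono mult_pos_pos) auto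
    also have "\<dots> = 1 / (4 * real n ^ 3)" by (simp add: power_numeral_reduce)
    finally show "real n / (16 * (S n)\<^sup>2) < 1 / (4 * real n ^ 3)" .
  qed (use S in simp)
  also have "\<dots> = edge_weight n / (4 * (real n)\<^sup>2)"
    by (simp add: edge_weight_def power_numeral_reduce)
  also have "\<dots> \<le> V n" by (rule V_lower_bound[OF assms])
  finally show ?thesis .
qed

section \<open>Ground state representation with ground state sqrt n\<close>

text \<open>With s = sqrt n and t = sqrt(n+1), the squares (t \<beta> - s \<alpha>)^2 and s t
  (\<beta> - \<alpha>)^2 have the same cross term; the excess coefficients t^2 - s t and s^2 - s t
  give the first two summands.\<close>

lemma ground_state_step:
  fixes \<alpha> \<beta> :: real
  shows "(sqrt (real (Suc n)) * \<beta> - sqrt (real n) * \<alpha>)\<^sup>2 =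
    (1 - sqrt (1 - 1 / real (Suc n))) * (real (Suc n) * \<beta>\<^sup>2)
    + (1 - sqrt (1 + 1 / real n)) * (real n * \<alpha>\<^sup>2)
    + sqrt (real n) * sqrt (real (Suc n)) * (\<beta> - \<alpha>)\<^sup>2"
proof (cases "n = 0")
  case False
  define s t where "s = sqrt (real n)" and "t = sqrt (real (Suc n))"
  have st: "s > 0" "t > 0" "real n = s\<^sup>2" "real (Suc n) = t\<^sup>2"
    using False by (auto simp: s_def t_def)
  have "1 - 1 / real (Suc n) = real n / real (Suc n)" "1 + 1 / real n = real (Suc n) / real n"
    using False by (auto simp: field_simps)
  then have "sqrt (1 - 1 / real (Suc n)) = s / t" "sqrt (1 + 1 / real n) = t / s"
    by (simp_all only: real_sqrt_divide s_def t_def)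
  then show ?thesis
    unfolding s_def[symmetric] t_def[symmetric] unfolding st(3,4)
    using st(1,2) by (simp add: field_simps power2_eq_square)
\<comment> \<open>For n = 0 both sides are \<beta>^2: the summand containing
  \<open>1 / real 0\<close>, which is 0 in HOL, carries the factor \<open>real 0\<close>.\<close>
qed (simp add: power_mult_distrib)

text \<open>This sums \<open>ground_state_step\<close> over the edges. By \<open>V_eq\<close> each
  vertex before N collects its full weight from its two edges; vertex N lacks its outgoing edge, and
  the boundary term compensates for that.\<close>

lemma ground_state_identity:
  fixes \<phi> :: "nat \<Rightarrow> real"
  shows "(\<Sum>k<N. edge_weight (Suc k) *
           (sqrt (real (Suc k)) * \<phi> (Suc k) - sqrt (real k) * \<phi> k)\<^sup>2) =
    (\<Sum>k<N. V (Suc k) * (real (Suc k) * (\<phi> (Suc k))\<^sup>2))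
    + edge_weight (Suc N) * (sqrt (1 + 1 / real N) - 1) * (real N * (\<phi> N)\<^sup>2)
    + (\<Sum>k<N. edge_weight (Suc k) * (sqrt (real k) * sqrt (real (Suc k)) * (\<phi> (Suc k) - \<phi> k)\<^sup>2))"
proof (induction N)
  case (Suc N)
  \<comment> \<open>The old boundary term cancels the share of vertex N in the new edge.\<close>
  show ?case
    unfolding sum.lessThan_Suc Suc.IH unfolding ground_state_step V_eq[of "Suc N"]
    by algebra
qed simp

lemma V_sum_le_edge_sum:
  fixes x :: "nat \<Rightarrow> real"
  assumes "x 0 = 0"
  shows "(\<Sum>k<N. V (Suc k) * (x (Suc k))\<^sup>2) \<le> (\<Sum>k<N. edge_weight (Suc k) * (x (Suc k) - x k)\<^sup>2)"
proof -
  \<comment> \<open>At n = 0 division by zero gives \<open>\<phi> 0 = 0\<close>, and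
    \<open>x 0 = 0\<close> keeps the factorisation valid there.\<close>
  define \<phi> where "\<phi> n = x n / sqrt (real n)" for n
  have x: "x n = sqrt (real n) * \<phi> n" for n
    using assms by (cases "n = 0") (auto simp: \<phi>_def)
  have x2: "(x n)\<^sup>2 = real n * (\<phi> n)\<^sup>2" for n
    by (simp add: x power_mult_distrib)
  have "0 \<le> edge_weight (Suc N) * (sqrt (1 + 1 / real N) - 1) * (real N * (\<phi> N)\<^sup>2)"
    by (intro mult_nonneg_nonneg edge_weight_nonneg) auto
  moreover have "0 \<le> (\<Sum>k<N. edge_weight (Suc k) *
      (sqrt (real k) * sqrt (real (Suc k)) * (\<phi> (Suc k) - \<phi> k)\<^sup>2))"
    by (intro sum_nonneg mult_nonneg_nonneg edge_weight_nonneg) auto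
  ultimately show ?thesis
    unfolding x2 unfolding x ground_state_identity by linarith
qed

section \<open>The two inequalities for arbitrary scalar sequences\<close>

lemma A_0: "A a 0 = 0"
  by (simp add: A_def)

lemma A_Suc: "A a (Suc n) = A a n + of_nat (Suc n) * a (Suc n)"
  by (simp add: A_def)

text \<open>If all partial sums vanished, so would their differences n a_n. The index found here is
  where the first inequality becomes strict.\<close>

lemma exists_A_nonzero:
  assumes "n \<ge> 1" "a n \<noteq> (0::'a::real_normed_field)"
  shows "\<exists>k. A a (Suc k) \<noteq> 0"
proof (rule ccontr)
  assume "\<not> ?thesis"
  then have A0: "A a k = 0" for k by (cases k) (auto simp: A_0)
  obtain m where "n = Suc m" using assms by (cases n) auto
  with A_Suc[of a m] have "of_nat n * a n = 0" by (simp only: A0) simp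
  with assms show False by simp
qed

lemma copson_sum_eq:
  "copson_sum a = (\<Sum>n. ennreal (edge_weight (Suc n) * (norm (A a (Suc n) - A a n))\<^sup>2))"
  by (simp add: copson_sum_def edge_weight_def)

text \<open>The real inequality is applied to the norms of the A_n, and the reverse triangle
  inequality returns to the norms of the differences. Only partial sums are bounded, so neither
  series has to converge.\<close>

lemma weighted_sum_V_le_copson_sum: "weighted_sum V a \<le> copson_sum a"
  unfolding weighted_sum_def
proof (rule suminf_le_const)
  fix N :: nat
  have "(\<Sum>k<N. V (Suc k) * (norm (A a (Suc k)))\<^sup>2)
      \<le> (\<Sum>k<N. edge_weight (Suc k) * (norm (A a (Suc k)) - norm (A a k))\<^sup>2)"
    by (rule V_sum_le_edge_sum) (simp add: A_0)
  also have "\<dots> \<le> (\<Sum>k<N. edge_weight (Suc k) * (norm (A a (Suc k) - A a k))\<^sup>2)"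
    by (intro sum_mono mult_left_mono edge_weight_nonneg)
       (simp add: abs_le_square_iff[symmetric] norm_triangle_ineq3)
  finally have "ennreal (\<Sum>k<N. V (Suc k) * (norm (A a (Suc k)))\<^sup>2)
      \<le> ennreal (\<Sum>k<N. edge_weight (Suc k) * (norm (A a (Suc k) - A a k))\<^sup>2)"
    by (rule ennreal_leI)
  then have "(\<Sum>k<N. ennreal (V (Suc k) * (norm (A a (Suc k)))\<^sup>2))
      \<le> (\<Sum>k<N. ennreal (edge_weight (Suc k) * (norm (A a (Suc k) - A a k))\<^sup>2))"
    by (subst (1 2) sum_ennreal)
       (auto intro!: mult_nonneg_nonneg edge_weight_nonneg less_imp_le[OF V_pos])
  also have "\<dots> \<le> copson_sum a"
    unfolding copson_sum_eq by (rule sum_le_suminf) auto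
  finally show "(\<Sum>k<N. ennreal (V (Suc k) * (norm (A a (Suc k)))\<^sup>2)) \<le> copson_sum a" .
qed auto

text \<open>With g = f + h the sum of h is at least h m > 0; finiteness of the sum of f makes adding
  it strictly increasing.\<close>

lemma suminf_ennreal_strict_mono:
  fixes f g :: "nat \<Rightarrow> ennreal"
  assumes le: "\<And>n. f n \<le> g n" and less: "f m < g m" and fin: "suminf f < \<infinity>"
  shows "suminf f < suminf g"
proof -
  define h where "h n = g n - f n" for n
  have fin': "f n < \<infinity>" for n
    using fin sum_le_suminf[of f "{n}"] by (auto intro: le_less_trans)
  have g: "g = (\<lambda>n. f n + h n)"
    using le by (auto simp: h_def add_diff_inverse_ennreal)
  have "0 < h m" using less by (simp add: h_def diff_gr0_ennreal fin')
  also have "h m \<le> suminf h" using sum_le_suminf[of h "{m}"] by simp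
  finally have "suminf f + 0 < suminf f + suminf h"
    using fin by (simp add: ennreal_add_left_cancel_less)
  also have "\<dots> = suminf g" unfolding g by (rule suminf_add) auto
  finally show ?thesis by simp
qed

lemma weighted_sum_strict_mono:
  assumes "\<And>n. n \<ge> 1 \<Longrightarrow> 0 \<le> u n" "\<And>n. n \<ge> 1 \<Longrightarrow> u n < v n"
    and "\<exists>n\<ge>1. a n \<noteq> (0::'a::real_normed_field)" and fin: "weighted_sum u a < \<infinity>"
  shows "weighted_sum u a < weighted_sum v a"
proof -
  obtain m where m: "A a (Suc m) \<noteq> 0" using assms(3) exists_A_nonzero by blast
  show ?thesis
    unfolding weighted_sum_def
  proof (rule suminf_ennreal_strict_mono)
    show "ennreal (u (Suc n) * (norm (A a (Suc n)))\<^sup>2) \<le> ennreal (v (Suc n) * (norm (A a (Suc n)))\<^sup>2)"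
      for n
      by (intro ennreal_leI mult_right_mono less_imp_le[OF assms(2)]) auto
    show "ennreal (u (Suc m) * (norm (A a (Suc m)))\<^sup>2) < ennreal (v (Suc m) * (norm (A a (Suc m)))\<^sup>2)"
      using m by (intro ennreal_lessI mult_strict_right_mono mult_pos_pos
          le_less_trans[OF assms(1,2)] assms(2)) auto
  qed (use fin in \<open>simp add: weighted_sum_def\<close>)
qed

section \<open>Optimality of the weight V\<close>

text \<open>Thanks to this, test sequences can be prescribed through the values of A
  directly.\<close>

lemma A_of_differences:
  assumes "x 0 = (0::'a::real_normed_field)"
  shows "A (\<lambda>n. (x n - x (n - 1)) / of_nat n) N = x N"
proof (induction N)
  case (Suc N)
  then show ?case unfolding A_Suc by (simp del: of_nat_Suc)
qed (simp add: A_0 assms)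

text \<open>Tests the assumed inequality on a finitely supported real sequence, embedded by
  \<open>of_real\<close>, for which both series become finite sums of reals.\<close>

lemma weighted_sum_le_copson_sum_finite:
  fixes x :: "nat \<Rightarrow> real"
  assumes W: "\<And>a :: nat \<Rightarrow> 'a::real_normed_field.
      \<exists>n\<ge>1. a n \<noteq> 0 \<Longrightarrow> weighted_sum W a \<le> copson_sum a"
    and W_nonneg: "\<And>n. n \<ge> 1 \<Longrightarrow> 0 \<le> W n"
    and x: "x 0 = 0" "x m \<noteq> 0" "\<And>n. n \<ge> N \<Longrightarrow> x n = 0"
  shows "(\<Sum>k<N. W (Suc k) * (x (Suc k))\<^sup>2) \<le> (\<Sum>k<N. edge_weight (Suc k) * (x (Suc k) - x k)\<^sup>2)"
proof -
  define a :: "nat \<Rightarrow> 'a" where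
    "a = (\<lambda>n. (of_real (x n) - of_real (x (n - 1))) / of_nat n)"
  have A: "A a n = of_real (x n)" for n
    using A_of_differences[of "\<lambda>n. of_real (x n) :: 'a"] by (simp add: a_def x(1))
  have "\<exists>n\<ge>1. a n \<noteq> 0"
  proof (rule ccontr)
    assume "\<not> ?thesis"
    then have "A a m = 0" by (simp add: A_def)
    then show False using x(2) by (simp add: A)
  qed
  then have "weighted_sum W a \<le> copson_sum a" by (rule W)
  moreover have "weighted_sum W a = (\<Sum>k<N. ennreal (W (Suc k) * (x (Suc k))\<^sup>2))"
    unfolding weighted_sum_def by (subst suminf_finite[of "{..<N}"]) (auto simp: A x(3))
  \<comment> \<open>The edge from N-1 to N has index k = N-1 and is kept; for k >= N both ends of
    the edge carry the value 0.\<close>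
  moreover have "copson_sum a = (\<Sum>k<N. ennreal (edge_weight (Suc k) * (x (Suc k) - x k)\<^sup>2))"
    unfolding copson_sum_eq
    by (subst suminf_finite[of "{..<N}"]) (auto simp: A x(3) simp flip: of_real_diff)
  ultimately have "ennreal (\<Sum>k<N. W (Suc k) * (x (Suc k))\<^sup>2)
      \<le> ennreal (\<Sum>k<N. edge_weight (Suc k) * (x (Suc k) - x k)\<^sup>2)"
    by (simp add: sum_ennreal W_nonneg edge_weight_nonneg)
  then show ?thesis
    by (rule ennreal_le_iff[THEN iffD1, rotated])
       (intro sum_nonneg mult_nonneg_nonneg edge_weight_nonneg, simp)
qed

text \<open>\<open>\<phi>\<close> is 1 up to m and 0 from N on. Across edge k in between it drops by
  1/((k+1) L), and the factor of that squared drop is at most k+1, so the energy is at most 1/L^2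
  times the sum of the 1/(k+1), which is L.\<close>

lemma harm_cutoff_energy_le:
  fixes m N :: nat
  assumes mN: "m \<le> N" and L: "L = harm N - harm m" "L > (0::real)"
  defines "\<phi> \<equiv> \<lambda>n. (harm N - harm (min N (max m n))) / L"
  shows "(\<Sum>k<N. edge_weight (Suc k) *
           (sqrt (real k) * sqrt (real (Suc k)) * (\<phi> (Suc k) - \<phi> k)\<^sup>2)) \<le> 1 / L"
proof -
  have "(\<Sum>k<N. edge_weight (Suc k) * (sqrt (real k) * sqrt (real (Suc k)) * (\<phi> (Suc k) - \<phi> k)\<^sup>2))
      \<le> (\<Sum>k<N. if k < m then 0 else 1 / (real (Suc k) * L\<^sup>2))"
  proof (rule sum_mono)
    fix k assume "k \<in> {..<N}"
    then have kN: "k < N" by simp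
    show "edge_weight (Suc k) * (sqrt (real k) * sqrt (real (Suc k)) * (\<phi> (Suc k) - \<phi> k)\<^sup>2)
        \<le> (if k < m then 0 else 1 / (real (Suc k) * L\<^sup>2))"
    proof (cases "k < m")
      case True
      then show ?thesis by (simp add: \<phi>_def max_absorb1)
    next
      case False
      have "\<phi> (Suc k) - \<phi> k = - (1 / (real (Suc k) * L))"
        using False kN
        by (simp add: \<phi>_def harm_Suc max_absorb2 min_absorb2 inverse_eq_divide
            del: of_nat_Suc flip: diff_divide_distrib)
      then have d: "(\<phi> (Suc k) - \<phi> k)\<^sup>2 = 1 / ((real (Suc k))\<^sup>2 * L\<^sup>2)"
        by (simp only: power2_minus power_divide power_mult_distrib power_one)
      have "sqrt (real k) * sqrt (real (Suc k)) \<le> sqrt (real (Suc k)) * sqrt (real (Suc k))"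
        by (intro mult_right_mono) auto
      then have "edge_weight (Suc k) * (sqrt (real k) * sqrt (real (Suc k)) * (\<phi> (Suc k) - \<phi> k)\<^sup>2)
          \<le> 1 * (real (Suc k) * (\<phi> (Suc k) - \<phi> k)\<^sup>2)"
        by (intro mult_mono edge_weight_le_1) auto
      also have "\<dots> = 1 / (real (Suc k) * L\<^sup>2)"
        unfolding d using L(2) by (simp add: power2_eq_square field_simps del: of_nat_Suc)
      finally show ?thesis using False by simp
    qed
  qed
  also have "\<dots> = (\<Sum>k\<in>{m..<N}. 1 / real (Suc k)) / L\<^sup>2"
    by (subst sum_divide_distrib, rule sum.mono_neutral_cong_right) auto
  also have "(\<Sum>k\<in>{m..<N}. 1 / real (Suc k)) = L"
    using sum_Suc_diff'[OF mN, of "harm :: nat \<Rightarrow> real"]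
    by (simp add: L(1) harm_Suc inverse_eq_divide)
  also have "L / L\<^sup>2 = 1 / L" by (simp add: power2_eq_square)
  finally show ?thesis .
qed

text \<open>A surplus of W at m contributes the same amount for every cut-off with
  \<open>\<phi> m = 1\<close>, while the energy of the cut-off can be made smaller than
  that.\<close>

lemma V_optimal:
  assumes W: "\<And>a :: nat \<Rightarrow> 'a::real_normed_field.
      \<exists>n\<ge>1. a n \<noteq> 0 \<Longrightarrow> weighted_sum W a \<le> copson_sum a"
    and WV: "\<And>n. n \<ge> 1 \<Longrightarrow> V n \<le> W n" and m: "m \<ge> 1"
  shows "W m = V m"
proof (rule ccontr)
  assume "W m \<noteq> V m"
  then have \<delta>: "W m - V m > 0" using WV[OF m] by simp
  define \<epsilon> where "\<epsilon> = (W m - V m) * real m"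
  have \<epsilon>: "\<epsilon> > 0" using \<delta> m by (simp add: \<epsilon>_def)
  \<comment> \<open>Divergence of the harmonic series lets L exceed 1/\<epsilon>, which puts the
    energy bound 1/L below the surplus \<epsilon>.\<close>
  obtain N where "harm N > 1 / \<epsilon> + (harm m :: real)"
    using harm_at_top filterlim_at_top_dense eventually_sequentially by (metis le_refl)
  define L :: real where "L = harm N - harm m"
  have L: "L > 1 / \<epsilon>" using \<open>harm N > _\<close> by (simp add: L_def)
  have "L > 0" using L \<epsilon> by (smt (verit) divide_pos_pos)
  have mN: "m < N"
    using \<open>L > 0\<close> by (simp add: L_def) (metis harm_mono leD leI)
  define \<phi> where "\<phi> n = (harm N - harm (min N (max m n))) / L" for n
  define x where "x n = sqrt (real n) * \<phi> n" for n
  have \<phi>m: "\<phi> m = 1" using mN \<open>L > 0\<close> by (simp add: \<phi>_def L_def)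
  have x2: "(x n)\<^sup>2 = real n * (\<phi> n)\<^sup>2" for n by (simp add: x_def power_mult_distrib)
  obtain m' where m': "m = Suc m'" using m by (cases m) auto
  have "\<epsilon> = (W (Suc m') - V (Suc m')) * (x (Suc m'))\<^sup>2"
    using \<phi>m by (simp add: \<epsilon>_def x2 m')
  \<comment> \<open>The other terms are nonnegative because W dominates V.\<close>
  also have "\<dots> \<le> (\<Sum>k<N. (W (Suc k) - V (Suc k)) * (x (Suc k))\<^sup>2)"
    by (rule member_le_sum) (use mN WV m' in auto)
  also have "\<dots> = (\<Sum>k<N. W (Suc k) * (x (Suc k))\<^sup>2) - (\<Sum>k<N. V (Suc k) * (x (Suc k))\<^sup>2)"
    by (simp add: left_diff_distrib sum_subtractf)
  also have "(\<Sum>k<N. W (Suc k) * (x (Suc k))\<^sup>2)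
      \<le> (\<Sum>k<N. edge_weight (Suc k) * (x (Suc k) - x k)\<^sup>2)"
  proof (rule weighted_sum_le_copson_sum_finite[OF W])
    show "0 \<le> W n" if "n \<ge> 1" for n using WV[OF that] V_pos[OF that] by simp
    show "x m \<noteq> 0" using m \<phi>m by (simp add: x_def)
    show "x n = 0" if "n \<ge> N" for n using that by (simp add: x_def \<phi>_def min_def max_def)
  qed (auto simp: x_def)
  also have "(\<Sum>k<N. edge_weight (Suc k) * (x (Suc k) - x k)\<^sup>2) - (\<Sum>k<N. V (Suc k) * (x (Suc k))\<^sup>2)
     = (\<Sum>k<N. edge_weight (Suc k) * (sqrt (real k) * sqrt (real (Suc k)) * (\<phi> (Suc k) - \<phi> k)\<^sup>2))"
  proof -
    \<comment> \<open>This removes the boundary term of \<open>ground_state_identity\<close>, so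
      that only the energy is left.\<close>
    have "\<phi> N = 0" using mN by (simp add: \<phi>_def)
    then show ?thesis unfolding x2 unfolding x_def ground_state_identity by simp
  qed
  also have "\<dots> \<le> 1 / L"
    unfolding \<phi>_def using mN \<open>L > 0\<close> by (intro harm_cutoff_energy_le) (auto simp: L_def)
  also have "\<dots> < \<epsilon>" using L \<epsilon> \<open>L > 0\<close> by (simp add: field_simps)
  finally show False by simp
qed

text \<open>Strictness is claimed when the left sum is finite, since two infinite values cannot be
  strictly ordered. Whenever \<open>copson_sum a\<close> is finite, so is that sum, by the other
  inequality and \<open>copson_weight_less_V\<close>.\<close>

theorem mainTheorem3:
  "(\<forall>a :: nat \<Rightarrow> 'a::real_normed_field. (\<exists>n\<ge>1. a n \<noteq> 0) \<longrightarrow>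
      (weighted_sum (\<lambda>n. 1 / 16 * (real n / (S n * sqrt (S n)))) a < \<infinity> \<longrightarrow>
         weighted_sum (\<lambda>n. 1 / 16 * (real n / (S n * sqrt (S n)))) a < weighted_sum V a) \<and>
      weighted_sum V a \<le> copson_sum a) \<and>
   (\<forall>W :: nat \<Rightarrow> real. (\<forall>n\<ge>1. W n \<ge> V n) \<longrightarrow>
      (\<forall>a :: nat \<Rightarrow> 'a. (\<exists>n\<ge>1. a n \<noteq> 0) \<longrightarrow> weighted_sum W a \<le> copson_sum a) \<longrightarrow>
      (\<forall>n\<ge>1. W n = V n))"
proof (intro conjI allI impI)
  fix a :: "nat \<Rightarrow> 'a"
  assume "\<exists>n\<ge>1. a n \<noteq> 0" "weighted_sum (\<lambda>n. 1 / 16 * (real n / (S n * sqrt (S n)))) a < \<infinity>"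
  then show "weighted_sum (\<lambda>n. 1 / 16 * (real n / (S n * sqrt (S n)))) a < weighted_sum V a"
    by (intro weighted_sum_strict_mono copson_weight_less_V) (auto simp: S_def)
next
  fix a :: "nat \<Rightarrow> 'a"
  show "weighted_sum V a \<le> copson_sum a" by (rule weighted_sum_V_le_copson_sum)
next
  fix W :: "nat \<Rightarrow> real" and n :: nat
  assume "\<forall>n\<ge>1. W n \<ge> V n"
    "\<forall>a :: nat \<Rightarrow> 'a. (\<exists>n\<ge>1. a n \<noteq> 0) \<longrightarrow> weighted_sum W a \<le> copson_sum a" "1 \<le> n"
  then show "W n = V n" by (intro V_optimal[where 'a = 'a]) auto
qed

end
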